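(* Let $v,w\ge 0$ be integers with $v+w\ge 5$. (1) If $v\le w+1$, then $cost\ \mathscr{ON}(v+w,v;4,1)=cost\ \mathscr{ON}(v+w,4)$. (2) If $v\ge w+1$, then $cost\ \mathscr{ON}(v+w,v;4,1)=\binom{v+w}{2}+\binom{v}{2}-\left\lfloor \frac{vw}{2}\right\rfloor$.
   Context: Let $n\ge v\ge 0$ and let $C>C'\ge 1$ be integers. Let $X$ be a set of $n$ vertices, $K_n$ the complete graph on $X$, and $V\subseteq X$ a fixed subset with $|V|=v$; write $w=n-v$. A grooming $N(n,C)$ is a partition of the edge set $E(K_n)$ into (nonempty, not necessarily connected) subgraphs $B_1,\dots,B_\Lambda$ of $K_n$, without isolated vertices, such that $|E(B_k)|\le C$ for all $k$. A grooming $N(n,v;C,C')$ is an $N(n,C)$ in which, moreover, each $B_k$ contains at most $C'$ edges having both ends in $V$. The (drop) cost of a grooming is $\sum_{k=1}^{\Lambda}|V(B_k)|$. $\mathscr{ON}(n,C)$ (respectively $\mathscr{ON}(n,v;C,C')$) denotes a grooming $N(n,C)$ (respectively $N(n,v;C,C')$) of minimum cost, and $cost\ \mathscr{ON}(n,C)$ (respectively $cost\ \mathscr{ON}(n,v;C,C')$) denotes that minimum cost. *)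

theory Defs
  imports Complex_Main "HOL-Library.Disjoint_Sets"
begin

text \<open>
  A subgraph without isolated vertices is determined by its edges, so a subgraph is represented
  by its set of edges, an edge by the set of its two ends, and the vertex set of a subgraph
  \<open>B\<close> is \<open>\<Union>B\<close>. All vertex sets are meant to be finite.
\<close>

definition complete_edges :: "'a set \<Rightarrow> 'a set set" where
  "complete_edges X = {e. e \<subseteq> X \<and> card e = 2}"

definition grooming :: "'a set \<Rightarrow> nat \<Rightarrow> 'a set set set \<Rightarrow> bool" where
  "grooming X C P \<longleftrightarrow> partition_on (complete_edges X) P \<and> (\<forall>B\<in>P. card B \<le> C)"

definition two_period_grooming ::
    "'a set \<Rightarrow> 'a set \<Rightarrow> nat \<Rightarrow> nat \<Rightarrow> 'a set set set \<Rightarrow> bool" where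
  "two_period_grooming X V C C' P \<longleftrightarrow>
     grooming X C P \<and> (\<forall>B\<in>P. card {e \<in> B. e \<subseteq> V} \<le> C')"

definition drop_cost :: "'a set set set \<Rightarrow> nat" where
  "drop_cost P = (\<Sum>B\<in>P. card (\<Union>B))"

text \<open>
  The minimum costs. For finite \<open>X\<close> and \<open>C, C' \<ge> 1\<close> the minima are attained, because putting
  each edge into a subgraph of its own is a grooming.
\<close>

definition cost_ON :: "'a set \<Rightarrow> nat \<Rightarrow> nat" where
  "cost_ON X C = (LEAST c. \<exists>P. grooming X C P \<and> drop_cost P = c)"

definition two_period_cost_ON :: "'a set \<Rightarrow> 'a set \<Rightarrow> nat \<Rightarrow> nat \<Rightarrow> nat" where
  "two_period_cost_ON X V C C' =
     (LEAST c. \<exists>P. two_period_grooming X V C C' P \<and> drop_cost P = c)"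

end

theory Submission
  imports Defs
begin

text \<open>Along the constructions a single edge costs 2, a triangle 3, a kite 4. So the cost is
  two per edge of \<open>V\<close>, plus one per triangle built on such an edge, plus one per
  pendant edge. Triangles with a common apex in \<open>W\<close> must have disjoint bases to use
  each crossing edge once, and different apexes need disjoint sets of bases; rotating one
  near-perfect matching modulo an odd number supplies them. The obstacle is the number of places for
  pendant edges. For w < v, the w apexes carry about v/2 triangles each, enough for the binom(w,2)
  edges of \<open>W\<close>. For v = w = 2h + 1 there are h(2h + 1) triangles, exactly the number of
  edges of \<open>W\<close>, but the 2h + 1 crossing edges missed by the matchings also want a
  place. This case cannot be bypassed: if v + w is even, enlarging \<open>V\<close> never reaches v
  = w + 1, and at v = w + 2 the lower bound exceeds binom(v+w,2) by v/2.\<close>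

text \<open>
  A subgraph with at most four edges has at least as many vertices as edges, and if it contains
  just one edge of \<open>V\<close>, equality forces two edges between \<open>V\<close> and \<open>W = X - V\<close>. There
  are \<open>v w\<close> such edges, so at least \<open>binom v 2 - v w / 2\<close> subgraphs have an excess vertex.
  For the upper bounds, an edge of \<open>V\<close> is closed to a triangle by a vertex of \<open>W\<close> along disjoint
  (near-)perfect matchings of \<open>V\<close>, and the edges of \<open>W\<close> are hung on these triangles, which makes
  them kites. If \<open>v \<le> w + 1\<close>, enlarging \<open>V\<close> only sharpens the constraint, so it suffices to
  treat \<open>v = w + 1\<close>, where both formulas agree, and \<open>v = w\<close>.
\<close>

section \<open>Lower bounds\<close>

lemma finite_complete_edges: "finite X \<Longrightarrow> finite (complete_edges X)"
  unfolding complete_edges_def by simp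

lemma card_complete_edges: "finite X \<Longrightarrow> card (complete_edges X) = card X choose 2"
  unfolding complete_edges_def by (rule n_subsets)

lemma two_choose_two: "2 * (n choose 2) = n * (n - 1)" for n :: nat
  by (cases n) (simp_all add: choose_two)

lemma choose_two_add: "(v + w) choose 2 = (v choose 2) + (w choose 2) + v * w" for v w :: nat
proof -
  have "2 * ((v + w) choose 2) = 2 * ((v choose 2) + (w choose 2) + v * w)"
    unfolding add_mult_distrib2 two_choose_two
    by (cases v; cases w) (simp_all add: algebra_simps)
  then show ?thesis by simp
qed

lemma card_edges_le_choose:
  assumes "finite (\<Union>B)" and "\<And>e. e \<in> B \<Longrightarrow> card e = 2"
  shows "card B \<le> card (\<Union>B) choose 2"
proof -
  have "B \<subseteq> complete_edges (\<Union>B)"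
    using assms(2) by (auto simp: complete_edges_def)
  then show ?thesis
    using card_mono[OF finite_complete_edges[OF assms(1)]] card_complete_edges[OF assms(1)]
    by metis
qed

lemma choose_two_small:
  "(0::nat) choose 2 = 0" "Suc 0 choose 2 = 0" "(2::nat) choose 2 = 1" "(3::nat) choose 2 = 3"
  by (simp_all add: choose_two)

text \<open>The bound 4 enters here: binom(m,2) is at most m for m up to 3, and from four vertices
  on the bound on the edges suffices.\<close>

lemma card_edges_le_card_vertices:
  assumes "finite (\<Union>B)" and "\<And>e. e \<in> B \<Longrightarrow> card e = 2" and "card B \<le> 4"
  shows "card B \<le> card (\<Union>B)"
proof -
  have *: "card B \<le> card (\<Union>B) choose 2" by (rule card_edges_le_choose[OF assms(1,2)])
  consider "card (\<Union>B) = 0" | "card (\<Union>B) = 1" | "card (\<Union>B) = 2" | "card (\<Union>B) = 3"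
    | "card (\<Union>B) \<ge> 4" by linarith
  then show ?thesis
    using * assms(3) by cases (simp_all add: choose_two_small)
qed

text \<open>One or two edges contain no cycle.\<close>

lemma card_edges_less_card_vertices:
  assumes "finite (\<Union>B)" and "\<And>e. e \<in> B \<Longrightarrow> card e = 2" and "card B \<le> 2" and "B \<noteq> {}"
  shows "card B < card (\<Union>B)"
proof -
  have *: "card B \<le> card (\<Union>B) choose 2" by (rule card_edges_le_choose[OF assms(1,2)])
  have "finite B" using assms(1) by (rule finite_UnionD)
  then have pos: "card B > 0" using assms(4) by (simp add: card_gt_0_iff)
  consider "card (\<Union>B) = 0" | "card (\<Union>B) = 1" | "card (\<Union>B) = 2" | "card (\<Union>B) \<ge> 3"
    by linarith
  then show ?thesis
    using * assms(3) pos by cases (simp_all add: choose_two_small)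
qed

definition crossing_edges :: "'a set \<Rightarrow> 'a set \<Rightarrow> 'a set set" where
  "crossing_edges V W = {e. card e = 2 \<and> e \<subseteq> V \<union> W \<and> \<not> e \<subseteq> V \<and> \<not> e \<subseteq> W}"

lemma complete_edges_Un:
  "complete_edges (V \<union> W) = complete_edges V \<union> complete_edges W \<union> crossing_edges V W"
  unfolding complete_edges_def crossing_edges_def by auto

lemma crossing_edges_disjoint:
  "complete_edges V \<inter> crossing_edges V W = {}" "complete_edges W \<inter> crossing_edges V W = {}"
  unfolding complete_edges_def crossing_edges_def by auto

lemma complete_edges_disjoint: "V \<inter> W = {} \<Longrightarrow> complete_edges V \<inter> complete_edges W = {}"
  unfolding complete_edges_def by (auto, metis card.empty inf_greatest subset_empty zero_neq_numeral)

lemma finite_crossing_edges: "finite V \<Longrightarrow> finite W \<Longrightarrow> finite (crossing_edges V W)"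
  using finite_complete_edges[of "V \<union> W"] by (simp add: complete_edges_Un)

lemma card_crossing_edges:
  assumes "finite V" "finite W" "V \<inter> W = {}"
  shows "card (crossing_edges V W) = card V * card W"
proof -
  note fin = finite_complete_edges[OF assms(1)] finite_complete_edges[OF assms(2)]
    finite_crossing_edges[OF assms(1,2)]
  have "card (complete_edges (V \<union> W))
      = card (complete_edges V) + card (complete_edges W) + card (crossing_edges V W)"
    unfolding complete_edges_Un
    using fin complete_edges_disjoint[OF assms(3)] crossing_edges_disjoint[where V = V and W = W]
    by (simp add: card_Un_disjoint Int_Un_distrib2)
  then show ?thesis
    using assms by (simp add: card_complete_edges card_Un_disjoint choose_two_add)
qed

text \<open>
  The weights are a dual solution: a block with an edge inside \<open>V\<close> and as many edges as vertices
  must contain two crossing edges.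
\<close>

lemma block_weight:
  assumes fin: "finite V" "finite W" and disj: "V \<inter> W = {}"
    and B: "B \<subseteq> complete_edges (V \<union> W)" "card B \<le> 4" "card (B \<inter> complete_edges V) \<le> 1"
  shows "2 * card B + 2 * card (B \<inter> complete_edges V)
    \<le> 2 * card (\<Union>B) + card (B \<inter> crossing_edges V W)"
proof -
  define D where "D = B \<inter> complete_edges W"
  define F where "F = B \<inter> crossing_edges V W"
  have UB: "\<Union>B \<subseteq> V \<union> W" using B(1) by (auto simp: complete_edges_def)
  have finUB: "finite (\<Union>B)" using UB fin by (meson finite_UnI finite_subset)
  have finB: "finite B" using finUB by (rule finite_UnionD)
  have card2: "card e = 2" if "e \<in> B" for e using B(1) that by (auto simp: complete_edges_def)
  have le: "card B \<le> card (\<Union>B)" by (rule card_edges_le_card_vertices[OF finUB card2 B(2)])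
  have split: "card B = card (B \<inter> complete_edges V) + card D + card F"
  proof -
    have "B = (B \<inter> complete_edges V) \<union> D \<union> F"
      using B(1) unfolding D_def F_def complete_edges_Un by auto
    moreover have "(B \<inter> complete_edges V) \<inter> D = {}" "((B \<inter> complete_edges V) \<union> D) \<inter> F = {}"
      using complete_edges_disjoint[OF disj] crossing_edges_disjoint[where V = V and W = W]
      unfolding D_def F_def by auto
    ultimately show ?thesis
      using finB by (metis card_Un_disjoint finite_Un)
  qed
  show ?thesis
  proof (cases "card (B \<inter> complete_edges V) = 0 \<or> card F \<ge> 2")
    case True
    then show ?thesis using le B(3) unfolding F_def by auto
  next
    \<comment> \<open>With one edge of \<open>V\<close> and at most one crossing edge, an excess
      vertex is forced: the edge of \<open>V\<close> brings two vertices, and the part of the block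
      in \<open>W\<close> has at least as many vertices as there are remaining edges.\<close>
    case False
    then have one: "card (B \<inter> complete_edges V) = 1" and F: "card F \<le> 1" using B(3) by auto
    then have "B \<inter> complete_edges V \<noteq> {}" by auto
    then obtain e where e: "e \<in> B" "e \<subseteq> V" "card e = 2"
      by (auto simp: complete_edges_def)
    have DW: "\<Union>D \<subseteq> \<Union>B \<inter> W" unfolding D_def by (auto simp: complete_edges_def)
    have finD: "finite (\<Union>D)" using DW finUB by (meson finite_Int finite_subset)
    have D2: "card e = 2" if "e \<in> D" for e using card2 that unfolding D_def by auto
    have "card (\<Union>B) = card (\<Union>B \<inter> V) + card (\<Union>B \<inter> W)"
    proof -
      have "\<Union>B = (\<Union>B \<inter> V) \<union> (\<Union>B \<inter> W)" using UB by auto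
      then show ?thesis using finUB disj
        by (metis (no_types, lifting) card_Un_disjoint finite_Un inf_assoc inf_bot_right inf_commute)
    qed
    moreover have "2 \<le> card (\<Union>B \<inter> V)"
      using e finUB by (metis Int_greatest Sup_upper card_mono finite_Int)
    moreover have "card D + card F \<le> card (\<Union>B \<inter> W)"
    proof (cases "F = {}")
      case True
      have "card D \<le> 4" using split B(2) by simp
      then have "card D \<le> card (\<Union>D)"
        using card_edges_le_card_vertices[OF finD] D2 by blast
      also have "\<dots> \<le> card (\<Union>B \<inter> W)" using DW finUB by (simp add: card_mono)
      finally show ?thesis using True by simp
    next
      case False
      have "finite F" using finB unfolding F_def by simp
      then have F1: "card F = 1" using False F by (simp add: card_gt_0_iff le_antisym Suc_leI)
      show ?thesis
      proof (cases "D = {}")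
        case True
        obtain f where "f \<in> F" using False by auto
        then have "f \<in> B" "f \<subseteq> V \<union> W" "\<not> f \<subseteq> V" unfolding F_def crossing_edges_def by auto
        then have "\<Union>B \<inter> W \<noteq> {}" by auto
        then have "card (\<Union>B \<inter> W) \<ge> 1" using finUB by (simp add: Suc_leI card_gt_0_iff)
        then show ?thesis using True F1 by simp
      next
        case False
        \<comment> \<open>The edge of \<open>V\<close> and the crossing edge leave room for two
          edges inside \<open>W\<close>, which are acyclic; the vertex gained this way pays for the
          crossing edge.\<close>
        have "card D \<le> 2" using split B(2) F1 one by simp
        then have "card D < card (\<Union>D)"
          using card_edges_less_card_vertices[OF finD] D2 False by blast
        also have "\<dots> \<le> card (\<Union>B \<inter> W)" using DW finUB by (simp add: card_mono)
        finally show ?thesis using F1 by simp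
      qed
    qed
    ultimately have "card B + 1 \<le> card (\<Union>B)" using split one by simp
    then show ?thesis using one by simp
  qed
qed

lemma grooming_finite:
  assumes "finite X" "grooming X C P"
  shows "finite P" "B \<in> P \<Longrightarrow> finite B"
proof -
  have *: "partition_on (complete_edges X) P" using assms(2) by (simp add: grooming_def)
  show "finite P" using finite_elements[OF finite_complete_edges[OF assms(1)] *] .
  show "B \<in> P \<Longrightarrow> finite B"
    using * finite_complete_edges[OF assms(1)] by (metis Union_upper finite_subset partition_onD1)
qed

lemma sum_card_grooming:
  assumes "finite X" "grooming X C P" "S \<subseteq> complete_edges X"
  shows "(\<Sum>B\<in>P. card (B \<inter> S)) = card S"
proof -
  have *: "partition_on (complete_edges X) P" using assms(2) by (simp add: grooming_def)
  have "card (\<Union>B\<in>P. B \<inter> S) = (\<Sum>B\<in>P. card (B \<inter> S))"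
    using grooming_finite[OF assms(1,2)] partition_onD2[OF *]
    by (intro card_UN_disjoint) (auto simp: disjoint_def)
  moreover have "(\<Union>B\<in>P. B \<inter> S) = S" using partition_onD1[OF *] assms(3) by auto
  ultimately show ?thesis by simp
qed

lemma drop_cost_ge:
  assumes "finite X" "grooming X 4 P"
  shows "card X choose 2 \<le> drop_cost P"
proof -
  have part: "\<Union>P = complete_edges X" "\<forall>B\<in>P. card B \<le> 4"
    using assms(2) partition_onD1 by (auto simp: grooming_def)
  have "card (B \<inter> complete_edges X) \<le> card (\<Union>B)" if "B \<in> P" for B
  proof -
    have sub: "B \<subseteq> complete_edges X" using part that by auto
    then have "\<Union>B \<subseteq> X" "\<And>e. e \<in> B \<Longrightarrow> card e = 2" by (auto simp: complete_edges_def)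
    then have "card B \<le> card (\<Union>B)"
      using part(2) that assms(1) by (meson card_edges_le_card_vertices finite_subset)
    then show ?thesis using sub by (simp add: Int_absorb2)
  qed
  then have "(\<Sum>B\<in>P. card (B \<inter> complete_edges X)) \<le> drop_cost P"
    unfolding drop_cost_def by (rule sum_mono)
  then show ?thesis
    using sum_card_grooming[OF assms, of "complete_edges X"] assms(1)
    by (simp add: card_complete_edges)
qed

text \<open>The weights of \<open>block_weight\<close> are summed over all blocks. Doubling keeps
  the half weight of a crossing edge integral; the rounding is left to the final theorem.\<close>

lemma two_period_drop_cost_ge:
  assumes fin: "finite V" "finite W" and disj: "V \<inter> W = {}"
    and P: "two_period_grooming (V \<union> W) V 4 1 P"
  shows "2 * (card (V \<union> W) choose 2) + 2 * (card V choose 2) \<le> 2 * drop_cost P + card V * card W"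
proof -
  have finX: "finite (V \<union> W)" using fin by simp
  have gr: "grooming (V \<union> W) 4 P" and V1: "\<forall>B\<in>P. card {e \<in> B. e \<subseteq> V} \<le> 1"
    using P by (auto simp: two_period_grooming_def)
  have part: "\<Union>P = complete_edges (V \<union> W)" "\<forall>B\<in>P. card B \<le> 4"
    using gr partition_onD1 by (auto simp: grooming_def)
  have "(\<Sum>B\<in>P. 2 * card (B \<inter> complete_edges (V \<union> W)) + 2 * card (B \<inter> complete_edges V))
      \<le> (\<Sum>B\<in>P. 2 * card (\<Union>B) + card (B \<inter> crossing_edges V W))"
  proof (rule sum_mono)
    fix B assume B: "B \<in> P"
    then have sub: "B \<subseteq> complete_edges (V \<union> W)" using part by auto
    have "B \<inter> complete_edges V = {e \<in> B. e \<subseteq> V}" using sub by (auto simp: complete_edges_def)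
    then have "card (B \<inter> complete_edges V) \<le> 1" using V1 B by simp
    then show "2 * card (B \<inter> complete_edges (V \<union> W)) + 2 * card (B \<inter> complete_edges V)
        \<le> 2 * card (\<Union>B) + card (B \<inter> crossing_edges V W)"
      using block_weight[OF fin disj sub] part(2) B sub by (simp add: Int_absorb2)
  qed
  moreover have "(\<Sum>B\<in>P. card (B \<inter> complete_edges (V \<union> W))) = card (V \<union> W) choose 2"
    using sum_card_grooming[OF finX gr order_refl] finX by (simp add: card_complete_edges)
  moreover have "(\<Sum>B\<in>P. card (B \<inter> complete_edges V)) = card V choose 2"
    using sum_card_grooming[OF finX gr, of "complete_edges V"] fin
    by (simp add: card_complete_edges complete_edges_Un Un_assoc)
  moreover have "(\<Sum>B\<in>P. card (B \<inter> crossing_edges V W)) = card V * card W"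
    using sum_card_grooming[OF finX gr, of "crossing_edges V W"] fin disj
    by (simp add: card_crossing_edges complete_edges_Un)
  ultimately show ?thesis
    by (simp add: sum.distrib sum_distrib_left[symmetric] drop_cost_def)
qed

section \<open>Groomings from covers\<close>

text \<open>
  Blocks may overlap and may contain edges outside \<open>S\<close>: shrinking them to a partition does not
  increase the cost.
\<close>

definition coverable :: "'a set \<Rightarrow> 'a set set \<Rightarrow> nat \<Rightarrow> bool" where
  "coverable V S c \<longleftrightarrow> (\<exists>P. finite P \<and> S \<subseteq> \<Union>P
     \<and> (\<forall>B\<in>P. finite (\<Union>B) \<and> card B \<le> 4 \<and> card {e \<in> B. e \<subseteq> V} \<le> 1)
     \<and> (\<Sum>B\<in>P. card (\<Union>B)) \<le> c)"

lemma grooming_of_coverable: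
  assumes "finite X" and "coverable V (complete_edges X) c"
  shows "\<exists>P. two_period_grooming X V 4 1 P \<and> drop_cost P \<le> c"
proof -
  let ?E = "complete_edges X"
  obtain P where P: "finite P" "?E \<subseteq> \<Union>P"
      "\<And>B. B \<in> P \<Longrightarrow> finite (\<Union>B) \<and> card B \<le> 4 \<and> card {e \<in> B. e \<subseteq> V} \<le> 1"
      "(\<Sum>B\<in>P. card (\<Union>B)) \<le> c"
    using assms(2) unfolding coverable_def by auto
  have "\<forall>e\<in>?E. \<exists>B. B \<in> P \<and> e \<in> B" using P(2) by blast
  then obtain f where f: "\<And>e. e \<in> ?E \<Longrightarrow> f e \<in> P \<and> e \<in> f e" by metis
  define fib where "fib B = {e \<in> ?E. f e = B}" for B
  have fib: "fib B \<subseteq> B" "finite B" if "B \<in> P" for B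
    using f P(3)[OF that] that finite_UnionD unfolding fib_def by auto
  have sub: "f ` ?E \<subseteq> P" using f by auto
  \<comment> \<open>Only blocks chosen by some edge are used, so no fibre is empty, as a partition
    requires.\<close>
  define Q where "Q = fib ` f ` ?E"
  have "partition_on ?E Q"
    unfolding partition_on_def disjoint_def Q_def fib_def by auto
  moreover have "card B \<le> 4 \<and> card {e \<in> B. e \<subseteq> V} \<le> 1" if "B \<in> Q" for B
  proof -
    from that obtain A where A: "A \<in> P" "B = fib A" using sub unfolding Q_def by blast
    have "card B \<le> card A" using fib[OF A(1)] A(2) by (simp add: card_mono)
    moreover have "card {e \<in> B. e \<subseteq> V} \<le> card {e \<in> A. e \<subseteq> V}"
      using fib[OF A(1)] A(2) by (intro card_mono) auto
    ultimately show ?thesis using P(3)[OF A(1)] by linarith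
  qed
  ultimately have "two_period_grooming X V 4 1 Q"
    unfolding two_period_grooming_def grooming_def by auto
  moreover have "drop_cost Q \<le> c"
  proof -
    have "drop_cost Q \<le> (\<Sum>B\<in>f ` ?E. card (\<Union>(fib B)))"
      unfolding drop_cost_def Q_def
      using sum_image_le[of "f ` ?E" "\<lambda>B. card (\<Union>B)" fib] finite_complete_edges[OF assms(1)]
      by (simp add: comp_def)
    also have "\<dots> \<le> (\<Sum>B\<in>f ` ?E. card (\<Union>B))"
    proof (rule sum_mono)
      fix B assume "B \<in> f ` ?E"
      then have "B \<in> P" using sub by auto
      then show "card (\<Union>(fib B)) \<le> card (\<Union>B)" using P(3) fib by (simp add: Union_mono card_mono)
    qed
    also have "\<dots> \<le> (\<Sum>B\<in>P. card (\<Union>B))" using P(1) sub by (simp add: sum_mono2)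
    finally show ?thesis using P(4) by simp
  qed
  ultimately show ?thesis by blast
qed

lemma coverable_mono:
  assumes "coverable V S c" "S' \<subseteq> S" "c \<le> c'"
  shows "coverable V S' c'"
  using assms unfolding coverable_def by (meson order_trans)

lemma coverable_antimono:
  assumes "coverable V S c" "V' \<subseteq> V"
  shows "coverable V' S c"
proof -
  obtain P where P: "finite P" "S \<subseteq> \<Union>P"
      "\<And>B. B \<in> P \<Longrightarrow> finite (\<Union>B) \<and> card B \<le> 4 \<and> card {e \<in> B. e \<subseteq> V} \<le> 1"
      "(\<Sum>B\<in>P. card (\<Union>B)) \<le> c"
    using assms(1) unfolding coverable_def by auto
  have "card {e \<in> B. e \<subseteq> V'} \<le> 1" if "B \<in> P" for B
  proof -
    have "finite B" using P(3)[OF that] finite_UnionD by auto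
    then have "card {e \<in> B. e \<subseteq> V'} \<le> card {e \<in> B. e \<subseteq> V}"
      using assms(2) by (intro card_mono) auto
    then show ?thesis using P(3)[OF that] by linarith
  qed
  then show ?thesis using P unfolding coverable_def by blast
qed

lemma coverable_empty: "coverable V {} 0"
  unfolding coverable_def by (rule exI[of _ "{}"]) simp

lemma coverable_Un:
  assumes "coverable V S c" "coverable V S' c'"
  shows "coverable V (S \<union> S') (c + c')"
proof -
  obtain P where P: "finite P" "S \<subseteq> \<Union>P"
      "\<forall>B\<in>P. finite (\<Union>B) \<and> card B \<le> 4 \<and> card {e \<in> B. e \<subseteq> V} \<le> 1"
      "(\<Sum>B\<in>P. card (\<Union>B)) \<le> c"
    using assms(1) unfolding coverable_def by auto
  obtain P' where P': "finite P'" "S' \<subseteq> \<Union>P'"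
      "\<forall>B\<in>P'. finite (\<Union>B) \<and> card B \<le> 4 \<and> card {e \<in> B. e \<subseteq> V} \<le> 1"
      "(\<Sum>B\<in>P'. card (\<Union>B)) \<le> c'"
    using assms(2) unfolding coverable_def by auto
  have "(\<Sum>B\<in>P \<union> P'. card (\<Union>B)) + (\<Sum>B\<in>P \<inter> P'. card (\<Union>B))
      = (\<Sum>B\<in>P. card (\<Union>B)) + (\<Sum>B\<in>P'. card (\<Union>B))"
    using P(1) P'(1) by (rule sum.union_inter)
  then have "(\<Sum>B\<in>P \<union> P'. card (\<Union>B)) \<le> c + c'" using P(4) P'(4) by linarith
  then show ?thesis
    using P(1-3) P'(1-3) unfolding coverable_def by (intro exI[of _ "P \<union> P'"]) auto
qed

lemma coverable_UN:
  assumes "finite A" "\<And>i. i \<in> A \<Longrightarrow> coverable V (S i) c"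
  shows "coverable V (\<Union>i\<in>A. S i) (c * card A)"
  using assms
proof (induction A rule: finite_induct)
  case empty
  show ?case by (simp add: coverable_empty)
next
  case (insert i A)
  then have "coverable V (S i \<union> (\<Union>i\<in>A. S i)) (c + c * card A)"
    by (intro coverable_Un) auto
  then show ?case using insert.hyps by simp
qed

section \<open>Elementary blocks and their costs\<close>

text \<open>Only \<open>e0\<close> may lie inside \<open>V\<close>. Edges may be repeated, so paths
  and triangles are instances too.\<close>

lemma coverable_block:
  assumes "\<not> e1 \<subseteq> V" "\<not> e2 \<subseteq> V" "\<not> e3 \<subseteq> V"
    and "finite (e0 \<union> e1 \<union> e2 \<union> e3)" "card (e0 \<union> e1 \<union> e2 \<union> e3) \<le> c"
  shows "coverable V {e0, e1, e2, e3} c"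
proof -
  have "{e \<in> {e0, e1, e2, e3}. e \<subseteq> V} \<subseteq> {e0}" using assms(1-3) by auto
  from card_mono[OF _ this] have "card {e \<in> {e0, e1, e2, e3}. e \<subseteq> V} \<le> 1" by simp
  moreover have "card {e0, e1, e2, e3} \<le> 4"
    using card_length[of "[e0, e1, e2, e3]"] by simp
  ultimately show ?thesis
    unfolding coverable_def using assms(4,5)
    by (intro exI[of _ "{{e0, e1, e2, e3}}"]) (simp add: Un_assoc)
qed

lemma coverable_edge: "coverable V {{a, b}} 2"
proof -
  have "{e. e = {a, b} \<and> e \<subseteq> V} \<subseteq> {{a, b}}" by auto
  from card_mono[OF _ this] have "card {e. e = {a, b} \<and> e \<subseteq> V} \<le> 1" by simp
  then show ?thesis
    unfolding coverable_def using card_length[of "[a, b]"]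
    by (intro exI[of _ "{{{a, b}}}"]) simp
qed

lemma coverable_path:
  assumes "y \<notin> V"
  shows "coverable V {{a, b}, {b, y}} 3"
proof -
  have "card {a, b, y} \<le> 3" using card_length[of "[a, b, y]"] by simp
  moreover have "{a, b} \<union> {b, y} \<union> {b, y} \<union> {b, y} = {a, b, y}" by auto
  ultimately have "coverable V {{a, b}, {b, y}, {b, y}, {b, y}} 3"
    using assms by (intro coverable_block) simp_all
  then show ?thesis by simp
qed

lemma coverable_triangle:
  assumes "y \<notin> V"
  shows "coverable V {{a, b}, {a, y}, {b, y}} 3"
proof -
  have "card {a, b, y} \<le> 3" using card_length[of "[a, b, y]"] by simp
  moreover have "{a, b} \<union> {a, y} \<union> {b, y} \<union> {b, y} = {a, b, y}" by auto
  ultimately have "coverable V {{a, b}, {a, y}, {b, y}, {b, y}} 3"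
    using assms by (intro coverable_block) simp_all
  then show ?thesis by simp
qed

lemma coverable_kite:
  assumes "y \<notin> V" "s \<in> {a, b, y}" "\<not> {s, t} \<subseteq> V"
  shows "coverable V {{a, b}, {a, y}, {b, y}, {s, t}} 4"
proof -
  have "card {a, b, y, t} \<le> 4" using card_length[of "[a, b, y, t]"] by simp
  moreover have "{a, b} \<union> {a, y} \<union> {b, y} \<union> {s, t} = {a, b, y, t}" using assms(2) by auto
  ultimately show ?thesis using assms by (intro coverable_block) simp_all
qed

lemma coverable_4_cycle:
  assumes "y \<notin> V" "z \<notin> V"
  shows "coverable V {{a, b}, {a, y}, {b, z}, {y, z}} 4"
proof -
  have "card {a, b, y, z} \<le> 4" using card_length[of "[a, b, y, z]"] by simp
  moreover have "{a, b} \<union> {a, y} \<union> {b, z} \<union> {y, z} = {a, b, y, z}" by auto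
  ultimately show ?thesis using assms by (intro coverable_block) simp_all
qed

text \<open>The cost is additive: a base edge has two vertices, closing it at \<open>y i\<close>
  adds a third, and a pendant edge at one of these three adds a fourth.\<close>

lemma coverable_kites:
  assumes "finite A" "I \<subseteq> A" "J \<subseteq> I" and "\<And>i. i \<in> I \<Longrightarrow> y i \<notin> V"
    and "\<And>i. i \<in> J \<Longrightarrow> s i \<in> {a i, b i, y i} \<and> \<not> {s i, t i} \<subseteq> V"
  shows "coverable V ((\<Union>i\<in>A. {{a i, b i}}) \<union> (\<Union>i\<in>I. {{a i, y i}, {b i, y i}})
      \<union> (\<Union>i\<in>J. {{s i, t i}})) (2 * card A + card I + card J)"
proof -
  have fin: "finite I" using assms(1,2) by (rule rev_finite_subset)
  then have finJ: "finite J" using assms(3) by (rule rev_finite_subset)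
  have "coverable V (\<Union>i\<in>A - I. {{a i, b i}}) (2 * card (A - I))"
    using assms(1) by (intro coverable_UN coverable_edge) simp
  moreover have "coverable V (\<Union>i\<in>I - J. {{a i, b i}, {a i, y i}, {b i, y i}}) (3 * card (I - J))"
    using assms(4) fin by (intro coverable_UN coverable_triangle) auto
  moreover have "coverable V (\<Union>i\<in>J. {{a i, b i}, {a i, y i}, {b i, y i}, {s i, t i}}) (4 * card J)"
  proof (rule coverable_UN[OF finJ])
    fix i assume "i \<in> J"
    then show "coverable V {{a i, b i}, {a i, y i}, {b i, y i}, {s i, t i}} 4"
      using assms(3-5) by (intro coverable_kite) blast+
  qed
  ultimately have cov: "coverable V ((\<Union>i\<in>A - I. {{a i, b i}})
      \<union> (\<Union>i\<in>I - J. {{a i, b i}, {a i, y i}, {b i, y i}})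
      \<union> (\<Union>i\<in>J. {{a i, b i}, {a i, y i}, {b i, y i}, {s i, t i}}))
      (2 * card (A - I) + 3 * card (I - J) + 4 * card J)"
    by (meson coverable_Un)
  show ?thesis
  proof (rule coverable_mono[OF cov])
    have "card (A - I) + card I = card A" "card (I - J) + card J = card I"
      using assms(1-3) fin finJ by (simp_all add: card_Diff_subset card_mono)
    then show "2 * card (A - I) + 3 * card (I - J) + 4 * card J \<le> 2 * card A + card I + card J"
      by linarith
  qed (use assms(2,3) in auto)
qed

section \<open>Residues\<close>

text \<open>Representatives modulo 2h + 1, chosen symmetric about 0 so that negation needs no
  reduction; the pairs {i, -i} recur in the constructions.\<close>

definition residues :: "nat \<Rightarrow> int set" where
  "residues h = {- int h..int h}"

definition res :: "nat \<Rightarrow> int \<Rightarrow> int" where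
  "res h i = (i + int h) mod (2 * int h + 1) - int h"

lemma finite_residues: "finite (residues h)" and card_residues: "card (residues h) = 2 * h + 1"
  unfolding residues_def by simp_all

lemma res_in: "res h i \<in> residues h"
proof -
  have "0 \<le> (i + int h) mod (2 * int h + 1)" "(i + int h) mod (2 * int h + 1) < 2 * int h + 1"
    by (intro pos_mod_sign pos_mod_bound; simp)+
  then show ?thesis unfolding res_def residues_def by simp
qed

lemma res_eq_iff: "res h i = res h j \<longleftrightarrow> (2 * int h + 1) dvd (i - j)"
  unfolding res_def by (simp add: mod_eq_dvd_iff)

lemma res_ident: "i \<in> residues h \<Longrightarrow> res h i = i"
  unfolding res_def residues_def by simp

lemma res_dvd: "(2 * int h + 1) dvd (res h i - i)"
  using res_eq_iff[of h "res h i" i] res_ident[OF res_in] by simp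

lemma res_eqI: "i \<in> residues h \<Longrightarrow> (2 * int h + 1) dvd (i - j) \<Longrightarrow> i = res h j"
  using res_eq_iff[of h i j] res_ident by simp

lemma residues_eqI:
  "i \<in> residues h \<Longrightarrow> j \<in> residues h \<Longrightarrow> (2 * int h + 1) dvd (i - j) \<Longrightarrow> i = j"
  using res_eqI res_ident by metis

lemma res_nonzero:
  assumes "d \<in> {1..int h}"
  shows "\<not> (2 * int h + 1) dvd d"
  using assms zdvd_imp_le[of "2 * int h + 1" d] by auto

text \<open>The symmetric representative of i - j is nonzero; its absolute value is the distance
  \<open>d\<close>, and its sign decides between the two alternatives.\<close>

lemma residue_difference:
  assumes "i \<in> residues h" "j \<in> residues h" "i \<noteq> j"
  shows "\<exists>d\<in>{1..int h}. i = res h (j + d) \<and> j = res h (i - d)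
                   \<or> i = res h (j - d) \<and> j = res h (i + d)"
proof -
  define t where "t = res h (i - j)"
  have t: "t \<in> residues h" "(2 * int h + 1) dvd (t - (i - j))"
    unfolding t_def by (rule res_in, rule res_dvd)
  have "t \<noteq> 0" using t(2) assms residues_eqI[of i h j] by (auto simp: dvd_diff_commute)
  have "(2 * int h + 1) dvd (i - (j + t))" "(2 * int h + 1) dvd (j - (i - t))"
    using t(2) by (auto simp: dvd_diff_commute algebra_simps)
  then have "i = res h (j + t)" "j = res h (i - t)" using assms by (auto intro: res_eqI)
  then show ?thesis
    using t(1) \<open>t \<noteq> 0\<close> unfolding residues_def
    by (cases "t > 0") (auto intro!: bexI[of _ "\<bar>t\<bar>"])
qed

text \<open>Modulo 2h + 1 the inverse of 2 is h + 1, so every pair has a midpoint \<open>k\<close>.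
  It tells in which of the rotated matchings the pair lies.\<close>

lemma residue_midpoint:
  assumes "i \<in> residues h" "j \<in> residues h" "i \<noteq> j"
  shows "\<exists>k\<in>residues h. \<exists>d\<in>{1..int h}. {i, j} = {res h (k + d), res h (k - d)}"
proof -
  define k where "k = res h ((i + j) * (int h + 1))"
  have k: "k \<in> residues h" "(2 * int h + 1) dvd (k - (i + j) * (int h + 1))"
    unfolding k_def by (rule res_in, rule res_dvd)
  have k2: "(2 * int h + 1) dvd (2 * k - (i + j))"
  proof -
    have "2 * k - (i + j) = 2 * (k - (i + j) * (int h + 1)) + (2 * int h + 1) * (i + j)"
      by (simp add: algebra_simps)
    then show ?thesis by (metis k(2) dvd_add dvd_mult dvd_triv_left)
  qed
  have "i \<noteq> k"
  proof
    assume "i = k"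
    then have "(2 * int h + 1) dvd (i - j)" using k2 by simp
    then show False using assms residues_eqI by blast
  qed
  then obtain d where d: "d \<in> {1..int h}" "i = res h (k + d) \<or> i = res h (k - d)"
    using residue_difference[OF assms(1) k(1)] by auto
  have "j = res h (k - d)" if "i = res h (k + d)"
  proof (rule res_eqI[OF assms(2)])
    have "j - (k - d) = - (2 * k - (i + j)) - (i - (k + d))" by simp
    moreover have "(2 * int h + 1) dvd (i - (k + d))" using that res_dvd by simp
    ultimately show "(2 * int h + 1) dvd (j - (k - d))" using k2 by (metis dvd_diff dvd_minus_iff)
  qed
  moreover have "j = res h (k + d)" if "i = res h (k - d)"
  proof (rule res_eqI[OF assms(2)])
    have "j - (k + d) = - (2 * k - (i + j)) - (i - (k - d))" by simp
    moreover have "(2 * int h + 1) dvd (i - (k - d))" using that res_dvd by simp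
    ultimately show "(2 * int h + 1) dvd (j - (k + d))" using k2 by (metis dvd_diff dvd_minus_iff)
  qed
  ultimately show ?thesis using d k(1) by (intro bexI[of _ k] bexI[of _ d]) auto
qed

text \<open>A pair of residues is written as {k, k + d} with d in 1..h in one way only: reading it
  from the other end as well would make 2h + 1 divide d + e, which lies between 2 and 2h. Hence each
  edge of \<open>W\<close> is hung on a single triangle.\<close>

lemma card_forward_pairs:
  assumes "I \<subseteq> residues h" "finite E"
    and "\<And>k d. (k, d) \<in> J \<Longrightarrow> k \<in> I \<and> d \<in> {1..int h} \<and> {k, res h (k + d)} \<in> E"
  shows "card J \<le> card E"
proof (rule card_inj_on_le[of "\<lambda>(k, d). {k, res h (k + d)}"])
  show "inj_on (\<lambda>(k, d). {k, res h (k + d)}) J"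
  proof (rule inj_onI, clarsimp)
    fix k d l e
    assume kd: "(k, d) \<in> J" "(l, e) \<in> J" and eq: "{k, res h (k + d)} = {l, res h (l + e)}"
    have D: "k \<in> residues h" "l \<in> residues h" "d \<in> {1..int h}" "e \<in> {1..int h}"
      using assms(1) assms(3)[OF kd(1)] assms(3)[OF kd(2)] by auto
    from eq consider "k = l" "res h (k + d) = res h (l + e)"
      | "k = res h (l + e)" "l = res h (k + d)" by (auto simp: doubleton_eq_iff)
    then show "k = l \<and> d = e"
    proof cases
      case 1
      then have "(2 * int h + 1) dvd (d - e)" by (simp add: res_eq_iff)
      moreover have "d \<in> residues h" "e \<in> residues h" using D by (auto simp: residues_def)
      ultimately show ?thesis using 1 residues_eqI by blast
    next
      case 2
      then have "(2 * int h + 1) dvd (k - (l + e))" "(2 * int h + 1) dvd (l - (k + d))"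
        using res_dvd by metis+
      then have "(2 * int h + 1) dvd ((k - (l + e)) + (l - (k + d)))" by (rule dvd_add)
      moreover have "(k - (l + e)) + (l - (k + d)) = - (d + e)" by simp
      ultimately have "(2 * int h + 1) dvd (d + e)" by (metis dvd_minus_iff)
      then show ?thesis using D zdvd_imp_le[of "2 * int h + 1" "d + e"] by auto
    qed
  qed
qed (use assms in auto)

lemma res_add_neq: "k \<in> residues h \<Longrightarrow> d \<in> {1..int h} \<Longrightarrow> res h (k + d) \<noteq> k"
  using res_nonzero[of d h] res_dvd[of h "k + d"] by (metis add_diff_cancel_left' dvd_diff_commute)

section \<open>Base edges in V, spokes to an apex, rim edges between apexes\<close>

lemma doubleton_complete_edges: "{u, u'} \<in> complete_edges X \<longleftrightarrow> u \<in> X \<and> u' \<in> X \<and> u \<noteq> u'"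
  unfolding complete_edges_def by (auto simp: card_insert_if)

lemma complete_edges_subsetI:
  assumes "\<And>u u'. u \<in> V \<Longrightarrow> u' \<in> V \<Longrightarrow> u \<noteq> u' \<Longrightarrow> {u, u'} \<in> S"
    and "\<And>u u'. u \<in> V \<Longrightarrow> u' \<in> W \<Longrightarrow> u \<noteq> u' \<Longrightarrow> {u, u'} \<in> S"
    and "\<And>u u'. u \<in> W \<Longrightarrow> u' \<in> W \<Longrightarrow> u \<noteq> u' \<Longrightarrow> {u, u'} \<in> S"
  shows "complete_edges (V \<union> W) \<subseteq> S"
proof
  fix e assume "e \<in> complete_edges (V \<union> W)"
  then obtain u u' where "e = {u, u'}" "u \<noteq> u'" "u \<in> V \<union> W" "u' \<in> V \<union> W"
    by (auto simp: complete_edges_def card_2_iff)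
  then show "e \<in> S" using assms(1,3) assms(2)[of u u'] assms(2)[of u' u]
    by (auto simp: insert_commute[of u' u])
qed

lemma base_edge:
  assumes "i \<in> residues h" "j \<in> residues h" "i \<noteq> j"
  obtains k d where "k \<in> residues h" "d \<in> {1..int h}" "{a i, a j} = {a (res h (k + d)), a (res h (k - d))}"
proof -
  obtain k d where kd: "k \<in> residues h" "d \<in> {1..int h}" "{i, j} = {res h (k + d), res h (k - d)}"
    using residue_midpoint[OF assms] by blast
  from kd(3) have "a ` {i, j} = a ` {res h (k + d), res h (k - d)}" by (rule arg_cong)
  then have "{a i, a j} = {a (res h (k + d)), a (res h (k - d))}" by (simp only: image_insert image_empty)
  then show ?thesis using that kd(1,2) by blast
qed

lemma spoke_edge:
  assumes "i \<in> residues h" "k \<in> residues h" "i \<noteq> k"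
  obtains d where "d \<in> {1..int h}"
    "{a i, y} \<in> {{a (res h (k + d)), y}, {a (res h (k - d)), y}}"
  using residue_difference[OF assms] that by blast

lemma rim_edge:
  assumes "k \<in> I" "l \<in> I" "I \<subseteq> residues h" "k \<noteq> l"
  obtains k' l' d where "d \<in> {1..int h}" "l' = res h (k' + d)" "{k', l'} = {k, l}" "k' \<in> I" "l' \<in> I"
proof -
  have "k \<in> residues h" "l \<in> residues h" using assms by auto
  then obtain d where d: "d \<in> {1..int h}" "k = res h (l + d) \<or> l = res h (k + d)"
    using residue_difference[of k h l] assms(4) by blast
  then show ?thesis
    using that[of d k l] that[of d l k] assms(1,2) by (auto simp: insert_commute)
qed

text \<open>
  The edges of a complete graph on the residues modulo \<open>2 h + 1\<close> fall into near-perfect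
  matchings \<open>{{k + d, k - d} | 1 \<le> d \<le> h}\<close>. The triangles at the apex \<open>x k\<close> are then
  \<open>{a (k + d), a (k - d), x k}\<close>, and the one with parameter \<open>d\<close> takes the edge from \<open>x k\<close> to
  \<open>x (k + d)\<close> as its pendant edge.
\<close>

lemma coverable_wheels:
  assumes "finite A" "I \<subseteq> A" "J \<subseteq> I \<times> {1..int h}" and "\<And>k. k \<in> I \<Longrightarrow> x k \<notin> V"
    and "\<And>k d. (k, d) \<in> J \<Longrightarrow>
      s k d \<in> {a (res h (k + d)), a (res h (k - d)), x k} \<and> \<not> {s k d, t k d} \<subseteq> V"
  shows "coverable V ((\<Union>k\<in>A. \<Union>d\<in>{1..int h}. {{a (res h (k + d)), a (res h (k - d))}})
      \<union> (\<Union>k\<in>I. \<Union>d\<in>{1..int h}. {{a (res h (k + d)), x k}, {a (res h (k - d)), x k}})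
      \<union> (\<Union>(k, d)\<in>J. {{s k d, t k d}})) (2 * card A * h + card I * h + card J)"
proof -
  have "coverable V
      ((\<Union>p\<in>A \<times> {1..int h}. {{a (res h (fst p + snd p)), a (res h (fst p - snd p))}})
      \<union> (\<Union>p\<in>I \<times> {1..int h}. {{a (res h (fst p + snd p)), x (fst p)}, {a (res h (fst p - snd p)), x (fst p)}})
      \<union> (\<Union>p\<in>J. {{s (fst p) (snd p), t (fst p) (snd p)}}))
      (2 * card (A \<times> {1..int h}) + card (I \<times> {1..int h}) + card J)"
  proof (rule coverable_kites)
    show "finite (A \<times> {1..int h})" "I \<times> {1..int h} \<subseteq> A \<times> {1..int h}" "J \<subseteq> I \<times> {1..int h}"
      using assms(1-3) by auto
    show "x (fst p) \<notin> V" if "p \<in> I \<times> {1..int h}" for p using assms(4) that by auto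
    show "s (fst p) (snd p) \<in> {a (res h (fst p + snd p)), a (res h (fst p - snd p)), x (fst p)}
        \<and> \<not> {s (fst p) (snd p), t (fst p) (snd p)} \<subseteq> V" if "p \<in> J" for p
      using assms(5)[of "fst p" "snd p"] that by simp
  qed
  then show ?thesis
  proof (rule coverable_mono)
    show "2 * card (A \<times> {1..int h}) + card (I \<times> {1..int h}) + card J
        \<le> 2 * card A * h + card I * h + card J"
      by (simp add: card_cartesian_product)
  qed (auto simp: case_prod_unfold)
qed

section \<open>Constructions with fewer vertices in W than in V\<close>

text \<open>
  The extra vertex \<open>z\<close> completes each near-perfect matching by the edge \<open>{a k, z}\<close>.
\<close>

lemma coverable_even:
  fixes a x :: "int \<Rightarrow> 'a"
  assumes V: "V = insert z (a ` residues h)" and W: "W = x ` I" and I: "I \<subseteq> residues h" and disj: "V \<inter> W = {}"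
  shows "coverable V (complete_edges (V \<union> W))
    (2 * (h + 1) * (2 * h + 1) + (h + 1) * card I + (card I choose 2))"
proof -
  define J where "J = {(k, d) \<in> I \<times> {1..int h}. res h (k + d) \<in> I}"
  have finI: "finite I" using I finite_residues by (rule finite_subset)
  have xV: "x k \<notin> V" if "k \<in> I" for k using that disj W by blast
  have "card J \<le> card (complete_edges I)"
  proof (rule card_forward_pairs[OF I finite_complete_edges[OF finI]])
    fix k d assume "(k, d) \<in> J"
    then have "k \<in> I" "d \<in> {1..int h}" "res h (k + d) \<in> I" "k \<in> residues h"
      using I by (auto simp: J_def)
    then show "k \<in> I \<and> d \<in> {1..int h} \<and> {k, res h (k + d)} \<in> complete_edges I"
      using res_add_neq[of k h d] by (auto simp: doubleton_complete_edges)
  qed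
  then have J: "card J \<le> card I choose 2" by (simp add: card_complete_edges finI)
  define S1 where "S1 = (\<Union>k\<in>residues h. \<Union>d\<in>{1..int h}. {{a (res h (k + d)), a (res h (k - d))}})
    \<union> (\<Union>k\<in>I. \<Union>d\<in>{1..int h}. {{a (res h (k + d)), x k}, {a (res h (k - d)), x k}})
    \<union> (\<Union>(k, d)\<in>J. {{x k, x (res h (k + d))}})"
  define S2 where "S2 = (\<Union>k\<in>residues h. {{a k, z}}) \<union> (\<Union>k\<in>I. {{a k, x k}, {z, x k}})"
  have c1: "coverable V S1 (2 * card (residues h) * h + card I * h + card J)"
    unfolding S1_def using I xV
    by (intro coverable_wheels) (auto simp: finite_residues J_def)
  have c2: "coverable V S2 (2 * card (residues h) + card I)"
    using coverable_kites[of "residues h" I "{}" x V x a "\<lambda>_. z" x] I xV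
    unfolding S2_def by (simp add: finite_residues)
  have "complete_edges (V \<union> W) \<subseteq> S1 \<union> S2"
  proof (rule complete_edges_subsetI)
    have aa: "{a i, a j} \<in> S1" if "i \<in> residues h" "j \<in> residues h" "a i \<noteq> a j" for i j
    proof -
      obtain k d where "k \<in> residues h" "d \<in> {1..int h}" "{a i, a j} = {a (res h (k + d)), a (res h (k - d))}"
        by (rule base_edge[OF \<open>i \<in> residues h\<close> \<open>j \<in> residues h\<close>, of a]) (use \<open>a i \<noteq> a j\<close> in auto)
      then show ?thesis unfolding S1_def by blast
    qed
    fix u u' assume "u \<in> V" "u' \<in> V" "u \<noteq> u'"
    then show "{u, u'} \<in> S1 \<union> S2"
      unfolding V using aa by (auto simp: S2_def insert_commute)
  next
    fix u u' assume u: "u \<in> V" "u' \<in> W"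
    then obtain k where k: "k \<in> I" "u' = x k" using W by auto
    consider "u = z" | i where "i \<in> residues h" "u = a i" using u V by auto
    then show "{u, u'} \<in> S1 \<union> S2"
    proof cases
      case 1
      then show ?thesis using k by (auto simp: S2_def)
    next
      case 2
      show ?thesis
      proof (cases "i = k")
        case True
        then show ?thesis using 2 k by (auto simp: S2_def)
      next
        case False
        then obtain d where "d \<in> {1..int h}" "{a i, u'} \<in> {{a (res h (k + d)), u'}, {a (res h (k - d)), u'}}"
          by (rule spoke_edge[OF 2(1) subsetD[OF I k(1)]])
        then show ?thesis using 2 k unfolding S1_def by blast
      qed
    qed
  next
    fix u u' assume "u \<in> W" "u' \<in> W" "u \<noteq> u'"
    then obtain k l where kl: "k \<in> I" "l \<in> I" "u = x k" "u' = x l" "k \<noteq> l" using W by auto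
    obtain k' l' d where d: "d \<in> {1..int h}" "l' = res h (k' + d)" "{k', l'} = {k, l}" "k' \<in> I" "l' \<in> I"
      by (rule rim_edge[OF kl(1,2) I kl(5)])
    have "{u, u'} = x ` {k', l'}" using kl d(3) by simp
    moreover have "(k', d) \<in> J" using d by (auto simp: J_def)
    ultimately show "{u, u'} \<in> S1 \<union> S2" unfolding S1_def using d(2) by auto
  qed
  then show ?thesis
    using coverable_mono[OF coverable_Un[OF c1 c2]] J
    by (simp add: card_residues card_cartesian_product algebra_simps)
qed

text \<open>
  There is no apex for the matching at 0. Its edges \<open>{a i, a (- i)}\<close> absorb the edges
  \<open>{a k, x k}\<close> left over by the triangles, in 4-cycles through \<open>x i\<close> and \<open>x (- i)\<close>.
\<close>

lemma coverable_odd: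
  fixes a x :: "int \<Rightarrow> 'a" and p q h :: nat
  assumes V: "V = a ` residues h" and W: "W = x ` I" and I: "I = {- int p..int q} - {0}"
    and pq: "p \<le> q" "q \<le> h" and disj: "V \<inter> W = {}"
  shows "coverable V (complete_edges (V \<union> W))
    (4 * h * h + 2 * h + (p + q) * h + (p + q) + (((p + q) choose 2) - p))"
proof -
  \<comment> \<open>The rim edges {x i, x (- i)} are left out because the 4-cycles in
    \<open>S2\<close> contain them.\<close>
  define J where "J = {(k, d) \<in> I \<times> {1..int h}. res h (k + d) \<in> I \<and> res h (k + d) \<noteq> - k}"
  have finI: "finite I" and cardI: "card I = p + q" using I by auto
  have IK: "I \<subseteq> residues h - {0}" using pq I by (auto simp: residues_def)
  then have IK': "I \<subseteq> residues h" by auto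
  have xV: "x k \<notin> V" if "k \<in> I" for k using that disj W by blast
  define M where "M = (\<lambda>i. {i, - i}) ` {1..int p}"
  have M: "M \<subseteq> complete_edges I" "card M = p"
  proof -
    show "M \<subseteq> complete_edges I"
      using pq unfolding M_def I by (auto simp: doubleton_complete_edges)
    have "inj_on (\<lambda>i::int. {i, - i}) {1..int p}"
      by (rule inj_onI) (auto simp: doubleton_eq_iff)
    then show "card M = p" unfolding M_def by (simp add: card_image)
  qed
  have "card J \<le> card (complete_edges I - M)"
  proof (rule card_forward_pairs)
    show "I \<subseteq> residues h" by (rule IK')
    show "finite (complete_edges I - M)" using finite_complete_edges[OF finI] by simp
    fix k d assume "(k, d) \<in> J"
    then have kd: "k \<in> I" "d \<in> {1..int h}" "res h (k + d) \<in> I" "k \<in> residues h"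
        "res h (k + d) \<noteq> - k"
      using IK by (auto simp: J_def)
    moreover have "{k, res h (k + d)} \<notin> M"
      using kd(5) unfolding M_def by (auto simp: doubleton_eq_iff)
    ultimately show "k \<in> I \<and> d \<in> {1..int h} \<and> {k, res h (k + d)} \<in> complete_edges I - M"
      using res_add_neq[of k h d] by (auto simp: doubleton_complete_edges)
  qed
  then have J: "card J \<le> ((p + q) choose 2) - p"
    using M finI by (simp add: card_complete_edges card_Diff_subset finite_subset
        finite_complete_edges cardI)
  define S1 where "S1 = (\<Union>k\<in>residues h - {0}. \<Union>d\<in>{1..int h}. {{a (res h (k + d)), a (res h (k - d))}})
    \<union> (\<Union>k\<in>I. \<Union>d\<in>{1..int h}. {{a (res h (k + d)), x k}, {a (res h (k - d)), x k}})
    \<union> (\<Union>(k, d)\<in>J. {{x k, x (res h (k + d))}})"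
  \<comment> \<open>Row 0 splits by which of \<open>x i\<close> and \<open>x (- i)\<close> exist:
    both for i up to p (\<open>S2\<close>), only \<open>x i\<close> up to q (\<open>S3\<close>),
    neither beyond (\<open>S4\<close>). A 4-cycle takes two leftover spokes and a rim edge for two
    vertices more than its base edge, which saves p altogether.\<close>
  define S2 where
    "S2 = (\<Union>i\<in>{1..int p}. {{a i, a (- i)}, {a i, x i}, {a (- i), x (- i)}, {x i, x (- i)}})"
  define S3 where "S3 = (\<Union>i\<in>{int p + 1..int q}. {{a (- i), a i}, {a i, x i}})"
  define S4 where "S4 = (\<Union>i\<in>{int q + 1..int h}. {{a i, a (- i)}})"
  have c1: "coverable V S1 (2 * card (residues h - {0}) * h + card I * h + card J)"
    unfolding S1_def using IK xV
    by (intro coverable_wheels) (auto simp: finite_residues J_def)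
  have c2: "coverable V S2 (4 * card {1..int p})"
    unfolding S2_def using xV pq I by (intro coverable_UN coverable_4_cycle) auto
  have c3: "coverable V S3 (3 * card {int p + 1..int q})"
    unfolding S3_def using xV pq I by (intro coverable_UN coverable_path) auto
  have c4: "coverable V S4 (2 * card {int q + 1..int h})"
    unfolding S4_def by (intro coverable_UN coverable_edge) auto
  have row0: "{a i, a (- i)} \<in> S2 \<union> S3 \<union> S4" if "i \<in> {1..int h}" for i
  proof -
    consider "i \<le> int p" | "int p < i" "i \<le> int q" | "int q < i" by linarith
    then show ?thesis
    proof cases
      case 1
      then show ?thesis using that unfolding S2_def by auto
    next
      case 2
      then have "{a (- i), a i} \<in> S3" unfolding S3_def by auto
      then show ?thesis by (simp add: insert_commute)
    next
      case 3
      then show ?thesis using that unfolding S4_def by auto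
    qed
  qed
  have "complete_edges (V \<union> W) \<subseteq> S1 \<union> (S2 \<union> S3 \<union> S4)"
  proof (rule complete_edges_subsetI)
    fix u u' assume "u \<in> V" "u' \<in> V" "u \<noteq> u'"
    then obtain i j where ij: "i \<in> residues h" "j \<in> residues h" "u = a i" "u' = a j" "i \<noteq> j"
      using V by auto
    obtain k d where kd: "k \<in> residues h" "d \<in> {1..int h}"
        "{a i, a j} = {a (res h (k + d)), a (res h (k - d))}"
      by (rule base_edge[OF ij(1,2,5)])
    show "{u, u'} \<in> S1 \<union> (S2 \<union> S3 \<union> S4)"
    proof (cases "k = 0")
      case True
      have "res h d = d" "res h (- d) = - d"
        using kd(2) by (auto intro!: res_ident simp: residues_def)
      then have "{u, u'} = {a d, a (- d)}" using kd(3) True ij by simp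
      then show ?thesis using row0[OF kd(2)] by simp
    next
      case False
      then show ?thesis using kd ij unfolding S1_def by blast
    qed
  next
    fix u u' assume u: "u \<in> V" "u' \<in> W"
    then obtain k where k: "k \<in> I" "u' = x k" using W by auto
    obtain i where i: "i \<in> residues h" "u = a i" using u V by auto
    show "{u, u'} \<in> S1 \<union> (S2 \<union> S3 \<union> S4)"
    proof (cases "i = k")
      case True
      consider "k < 0" | "k > 0" "k \<le> int p" | "k > int p" "k \<le> int q" using k I by force
      then show ?thesis
      proof cases
        case 1
        then have "- k \<in> {1..int p}" using k I by auto
        then have "{a (- (- k)), x (- (- k))} \<in> S2" unfolding S2_def by blast
        then show ?thesis using True i k by simp
      next
        case 2
        then have "{a k, x k} \<in> S2" unfolding S2_def by auto
        then show ?thesis using True i k by simp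
      next
        case 3
        then have "{a k, x k} \<in> S3" unfolding S3_def by auto
        then show ?thesis using True i k by simp
      qed
    next
      case False
      then obtain d where "d \<in> {1..int h}"
          "{a i, u'} \<in> {{a (res h (k + d)), u'}, {a (res h (k - d)), u'}}"
        by (rule spoke_edge[OF i(1) subsetD[OF IK' k(1)]])
      then show ?thesis using i k unfolding S1_def by blast
    qed
  next
    fix u u' assume "u \<in> W" "u' \<in> W" "u \<noteq> u'"
    then obtain k l where kl: "k \<in> I" "l \<in> I" "u = x k" "u' = x l" "k \<noteq> l" using W by auto
    obtain k' l' d where d: "d \<in> {1..int h}" "l' = res h (k' + d)" "{k', l'} = {k, l}"
        "k' \<in> I" "l' \<in> I"
      by (rule rim_edge[OF kl(1,2) IK' kl(5)])
    have uu: "{u, u'} = x ` {k', l'}" using kl d(3) by simp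
    show "{u, u'} \<in> S1 \<union> (S2 \<union> S3 \<union> S4)"
    proof (cases "l' = - k'")
      case True
      have "k' \<le> int q" "- int p \<le> k'" "k' \<noteq> 0" "- k' \<le> int q" "- int p \<le> - k'"
        using d(4,5) True I by auto
      then have "\<bar>k'\<bar> \<in> {1..int p}" by (simp add: abs_if)
      then have "{x \<bar>k'\<bar>, x (- \<bar>k'\<bar>)} \<in> S2" unfolding S2_def by blast
      moreover have "{u, u'} = {x \<bar>k'\<bar>, x (- \<bar>k'\<bar>)}" using uu True by (auto simp: abs_if)
      ultimately show ?thesis by simp
    next
      case False
      then have "(k', d) \<in> J" using d by (auto simp: J_def)
      then show ?thesis unfolding S1_def using d(2) uu by auto
    qed
  qed
  moreover have "2 * card (residues h - {0}) * h + card I * h + card J + (4 * card {1..int p}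
      + 3 * card {int p + 1..int q} + 2 * card {int q + 1..int h})
      \<le> 4 * h * h + 2 * h + (p + q) * h + (p + q) + (((p + q) choose 2) - p)"
  proof -
    have "0 \<in> residues h" by (simp add: residues_def)
    then have "card (residues h - {0}) = 2 * h" by (simp add: card_residues finite_residues)
    moreover have "card {int p + 1..int q} = q - p" "card {int q + 1..int h} = h - q" by auto
    moreover have "4 * p + 3 * (q - p) + 2 * (h - q) = 2 * h + (p + q)" using pq by auto
    ultimately show ?thesis using J cardI by (simp add: algebra_simps)
  qed
  ultimately show ?thesis
    by (rule coverable_mono[OF coverable_Un[OF c1 coverable_Un[OF coverable_Un[OF c2 c3] c4]]])
qed

section \<open>Constructions with equally many vertices in V and W\<close>

text \<open>
  In the balanced cases the triangles have too few places for pendant edges, so some blocks avoid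
  the edges of \<open>V\<close>: the triangles formed by a hub (\<open>x 0\<close> or \<open>y\<close>), \<open>x i\<close> and \<open>x (- i)\<close>.
  They free places that the remaining edges can use.
\<close>

lemma antipode_iff:
  assumes "k \<in> residues h"
  shows "res h (k + d) = - k \<longleftrightarrow> k = res h (int h * d)"
proof
  assume "res h (k + d) = - k"
  then have "(2 * int h + 1) dvd (- k - (k + d))" using res_dvd by metis
  \<comment> \<open>The congruence 2k = -d is solved by multiplying with h, since 2h is -1 modulo 2h
    + 1.\<close>
  then have "(2 * int h + 1) dvd ((2 * int h + 1) * k + int h * (- k - (k + d)))" by simp
  moreover have "(2 * int h + 1) * k + int h * (- k - (k + d)) = k - int h * d"
    by (simp add: algebra_simps)
  ultimately show "k = res h (int h * d)" using assms by (auto intro: res_eqI)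
next
  assume "k = res h (int h * d)"
  then have "(2 * int h + 1) dvd (k - int h * d)" using res_dvd by simp
  then have "(2 * int h + 1) dvd ((2 * int h + 1) * (- d) - 2 * (k - int h * d))"
    by (metis dvd_diff dvd_mult dvd_triv_left)
  moreover have "(2 * int h + 1) * (- d) - 2 * (k - int h * d) = - k - (k + d)"
    by (simp add: algebra_simps)
  moreover have "- k \<in> residues h" using assms by (auto simp: residues_def)
  ultimately show "res h (k + d) = - k" by (metis res_eqI)
qed

text \<open>For each d exactly one k in \<open>A\<close> has k + d antipodal to k, namely the
  residue of h d. This counts the pendant places still needed once the rim edges {x i, x (- i)} sit
  in hub triangles.\<close>

lemma card_not_antipodal:
  assumes "A \<subseteq> residues h" and "\<And>d. d \<in> {1..int h} \<Longrightarrow> res h (int h * d) \<in> A"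
  shows "card {(k, d) \<in> A \<times> {1..int h}. res h (k + d) \<noteq> - k} \<le> h * (card A - 1)"
proof -
  have finA: "finite A" using assms(1) finite_residues by (rule finite_subset)
  have "{(k, d) \<in> A \<times> {1..int h}. res h (k + d) \<noteq> - k}
      \<subseteq> prod.swap ` (SIGMA d:{1..int h}. A - {res h (int h * d)})"
    using antipode_iff assms(1) by fastforce
  then have "card {(k, d) \<in> A \<times> {1..int h}. res h (k + d) \<noteq> - k}
      \<le> card (SIGMA d:{1..int h}. A - {res h (int h * d)})"
    using finA by (intro surj_card_le) auto
  also have "\<dots> = (\<Sum>d\<in>{1..int h}. card A - 1)"
    using finA assms(2) by (subst card_SigmaI) (auto intro!: sum.cong)
  finally show ?thesis by simp
qed

text \<open>The wheels have h(2h + 1) pendant places for the h(2h + 1) rim edges and the 2h + 1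
  spokes {a k, x k}. The h kites at the hub \<open>x 0\<close> take 3h rim edges and the h spokes
  with k > 0, leaving h(2h - 1) + 1 pendant edges. Edges and vertices then balance in every
  block.\<close>

lemma coverable_balanced_odd:
  fixes a x :: "int \<Rightarrow> 'a"
  assumes V: "V = a ` residues h" and W: "W = x ` residues h" and disj: "V \<inter> W = {}"
    and h: "h \<ge> 1"
  shows "coverable V (complete_edges (V \<union> W)) ((2 * h + 1) * (4 * h + 1))"
proof -
  define N where "N = {(k, d) \<in> (residues h - {0}) \<times> {1..int h}. res h (k + d) \<noteq> - k}"
  \<comment> \<open>Spokes {a k, x k} with k negative or 0 go to freed places: for k < 0 the place
    (k, -k), whose rim edge {x k, x 0} is already at the hub, and for k = 0 the place (0,
    1).\<close>
  define t where "t k d = (if k = 0 \<or> d = - k then a k else x (res h (k + d)))" for k d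
  have zero: "0 \<in> residues h" by (simp add: residues_def)
  have res_pos: "res h d = d" if "d \<in> {1..int h}" for d
    using that by (auto intro!: res_ident simp: residues_def)
  have xV: "x k \<notin> V" if "k \<in> residues h" for k using that disj W by blast
  have "res h (int h * d) \<in> residues h - {0}" if "d \<in> {1..int h}" for d
    using antipode_iff[OF zero, of d] res_pos[OF that] that res_in by auto
  then have "card N \<le> h * (card (residues h - {0}) - 1)"
    unfolding N_def by (intro card_not_antipodal) auto
  moreover have "card (residues h - {0}) = 2 * h"
    using zero by (simp add: card_residues finite_residues)
  ultimately have "card N \<le> h * (2 * h - 1)" by simp
  then have J: "card (insert (0, 1) N) \<le> 1 + h * (2 * h - 1)"
    using card_insert_le_m1[of "1 + h * (2 * h - 1)" N "(0, 1)"] by simp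
  define S1 where "S1 = (\<Union>k\<in>residues h. \<Union>d\<in>{1..int h}. {{a (res h (k + d)), a (res h (k - d))}})
    \<union> (\<Union>k\<in>residues h. \<Union>d\<in>{1..int h}. {{a (res h (k + d)), x k}, {a (res h (k - d)), x k}})
    \<union> (\<Union>(k, d)\<in>insert (0, 1) N. {{x k, t k d}})"
  define S2 where
    "S2 = (\<Union>i\<in>{1..int h}. {{x 0, x i}, {x 0, x (- i)}, {x i, x (- i)}, {x i, a i}})"
  have c1: "coverable V S1 (2 * card (residues h) * h + card (residues h) * h + card (insert (0, 1) N))"
    unfolding S1_def
  proof (rule coverable_wheels)
    show "insert (0, 1) N \<subseteq> residues h \<times> {1..int h}" using h zero by (auto simp: N_def)
    then show "x k \<in> {a (res h (k + d)), a (res h (k - d)), x k} \<and> \<not> {x k, t k d} \<subseteq> V"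
      if "(k, d) \<in> insert (0, 1) N" for k d
      using that xV by auto
  qed (use xV finite_residues in auto)
  have c2: "coverable V S2 (4 * card {1..int h})"
    unfolding S2_def
  proof (intro coverable_UN coverable_kite)
    fix i assume "i \<in> {1..int h}"
    then have "x i \<notin> V" "x (- i) \<notin> V" using xV by (auto simp: residues_def)
    then show "x (- i) \<notin> V" "\<not> {x i, a i} \<subseteq> V" "x i \<in> {x 0, x i, x (- i)}" by auto
  qed simp
  have rim0: "{x 0, x l} \<in> S2" if "l \<in> residues h" "l \<noteq> 0" for l
  proof -
    have "\<bar>l\<bar> \<in> {1..int h}" using that by (auto simp: residues_def)
    then have "{{x 0, x \<bar>l\<bar>}, {x 0, x (- \<bar>l\<bar>)}} \<subseteq> S2" unfolding S2_def by blast
    then show ?thesis by (cases "l < 0") simp_all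
  qed
  have "complete_edges (V \<union> W) \<subseteq> S1 \<union> S2"
  proof (rule complete_edges_subsetI)
    fix u u' assume "u \<in> V" "u' \<in> V" "u \<noteq> u'"
    then obtain i j where ij: "i \<in> residues h" "j \<in> residues h" "u = a i" "u' = a j" "i \<noteq> j"
      using V by auto
    obtain k d where kd: "k \<in> residues h" "d \<in> {1..int h}"
        "{a i, a j} = {a (res h (k + d)), a (res h (k - d))}"
      by (rule base_edge[OF ij(1,2,5)])
    then show "{u, u'} \<in> S1 \<union> S2" using ij unfolding S1_def by blast
  next
    fix u u' assume u: "u \<in> V" "u' \<in> W"
    then obtain k where k: "k \<in> residues h" "u' = x k" using W by auto
    obtain i where i: "i \<in> residues h" "u = a i" using u V by auto
    show "{u, u'} \<in> S1 \<union> S2"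
    proof (cases "i = k")
      case True
      consider "k = 0" | "k < 0" | "k > 0" by linarith
      then show ?thesis
      proof cases
        case 1
        then have "{x 0, t 0 1} \<in> S1" unfolding S1_def by blast
        then show ?thesis using True i k 1 by (simp add: t_def insert_commute)
      next
        case 2
        then have "(k, - k) \<in> N"
          using k res_ident[OF zero] by (auto simp: N_def residues_def)
        then have "{x k, t k (- k)} \<in> S1" unfolding S1_def by blast
        then show ?thesis using True i k by (simp add: t_def insert_commute)
      next
        case 3
        then have "{x k, a k} \<in> S2" using k unfolding S2_def by (auto simp: residues_def)
        then show ?thesis using True i k by (simp add: insert_commute)
      qed
    next
      case False
      then obtain d where "d \<in> {1..int h}"
          "{a i, u'} \<in> {{a (res h (k + d)), u'}, {a (res h (k - d)), u'}}"
        by (rule spoke_edge[OF i(1) k(1)])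
      then show ?thesis using i k unfolding S1_def by blast
    qed
  next
    fix u u' assume "u \<in> W" "u' \<in> W" "u \<noteq> u'"
    then obtain k l where kl: "k \<in> residues h" "l \<in> residues h" "u = x k" "u' = x l" "k \<noteq> l"
      using W by auto
    obtain k' l' d where d: "d \<in> {1..int h}" "l' = res h (k' + d)" "{k', l'} = {k, l}"
        "k' \<in> residues h" "l' \<in> residues h"
      by (rule rim_edge[OF kl(1,2) order_refl kl(5)])
    have uu: "{u, u'} = {x k', x l'}" using kl d(3) by (auto simp: doubleton_eq_iff)
    have neq: "k' \<noteq> l'" using d(3) kl(5) by auto
    consider "k' = 0" | "l' = 0" | "k' \<noteq> 0" "l' = - k'" | "k' \<noteq> 0" "l' \<noteq> 0" "l' \<noteq> - k'" by auto
    then show "{u, u'} \<in> S1 \<union> S2"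
    proof cases
      case 1
      then show ?thesis using uu rim0[of l'] d neq by simp
    next
      case 2
      then show ?thesis using uu rim0[of k'] d neq by (simp add: insert_commute)
    next
      case 3
      then have "\<bar>k'\<bar> \<in> {1..int h}" using d(4) by (auto simp: residues_def)
      then have "{x \<bar>k'\<bar>, x (- \<bar>k'\<bar>)} \<in> S2" unfolding S2_def by blast
      moreover have "{u, u'} = {x \<bar>k'\<bar>, x (- \<bar>k'\<bar>)}" using uu 3 by (auto simp: abs_if)
      ultimately show ?thesis by simp
    next
      case 4
      then have "(k', d) \<in> N" using d by (auto simp: N_def)
      then have "{x k', t k' d} \<in> S1" unfolding S1_def by blast
      moreover have "d \<noteq> - k'" using 4(2) d(2) res_ident[OF zero] by auto
      ultimately show ?thesis using 4 d(2) uu by (simp add: t_def)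
    qed
  qed
  moreover have "2 * card (residues h) * h + card (residues h) * h + card (insert (0, 1) N)
      + 4 * card {1..int h} \<le> (2 * h + 1) * (4 * h + 1)"
  proof -
    obtain g where "h = Suc g" using h by (cases h) auto
    then show ?thesis using J by (simp add: card_residues algebra_simps)
  qed
  ultimately show ?thesis by (rule coverable_mono[OF coverable_Un[OF c1 c2]])
qed

text \<open>Here \<open>z\<close> completes the matchings, so the wheels and the triangles {a k, z,
  x k} give (h + 1)(2h + 1) pendant places. The edges of \<open>W\<close> and the 2h + 2 edges from
  \<open>V\<close> to \<open>y\<close> exceed them by 2h + 2. The blocks at the hub \<open>y\<close>
  take 3h + 1 edges of \<open>W\<close>, leaving 2h^2 + 2h + 2 pendant edges.\<close>

lemma coverable_balanced_even:
  fixes a x :: "int \<Rightarrow> 'a"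
  assumes V: "V = insert z (a ` residues h)" and W: "W = insert y (x ` residues h)"
    and disj: "V \<inter> W = {}" and h: "h \<ge> 1"
  shows "coverable V (complete_edges (V \<union> W)) ((h + 1) * (8 * h + 6))"
proof -
  define N where "N = {(k, d) \<in> residues h \<times> {1..int h}. res h (k + d) \<noteq> - k}"
  \<comment> \<open>The place (h, 1) is free, as {x h, x (- h)} lies in a hub triangle. Its triangle
    contains a(h + 1) = a(-h), so {a (- h), y} can hang there.\<close>
  define s where "s k d = (if k = int h \<and> d = 1 then a (- int h) else x k)" for k d :: int
  define t where "t k d = (if k = int h \<and> d = 1 then y else x (res h (k + d)))" for k d :: int
  \<comment> \<open>The triangles {a k, z, x k} offer 2h + 1 places for the 2h + 2 edges from
    \<open>V\<close> to \<open>y\<close>. The one with k = -h serves \<open>z\<close>, and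
    \<open>a (- h)\<close> uses the place (h, 1) instead.\<close>
  define b where "b k = (if k = - int h then z else a k)" for k
  have top: "res h (int h + 1) = - int h"
  proof (rule res_eqI[symmetric])
    have "- int h - (int h + 1) = - (2 * int h + 1)" by simp
    then show "(2 * int h + 1) dvd (- int h - (int h + 1))" by (metis dvd_minus_iff dvd_refl)
  qed (simp add: residues_def)
  have xV: "x k \<notin> V" if "k \<in> residues h" for k using that disj W by blast
  have yV: "y \<notin> V" using disj W by blast
  have "card N \<le> h * (card (residues h) - 1)"
    unfolding N_def by (intro card_not_antipodal res_in) auto
  then have "card N \<le> h * (2 * h)" by (simp add: card_residues)
  then have J: "card (insert (int h, 1) N) \<le> 1 + h * (2 * h)"
    using card_insert_le_m1[of "1 + h * (2 * h)" N "(int h, 1)"] by simp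
  define S1 where "S1 = (\<Union>k\<in>residues h. \<Union>d\<in>{1..int h}. {{a (res h (k + d)), a (res h (k - d))}})
    \<union> (\<Union>k\<in>residues h. \<Union>d\<in>{1..int h}. {{a (res h (k + d)), x k}, {a (res h (k - d)), x k}})
    \<union> (\<Union>(k, d)\<in>insert (int h, 1) N. {{s k d, t k d}})"
  define S2 where "S2 = (\<Union>k\<in>residues h. {{a k, z}}) \<union> (\<Union>k\<in>residues h. {{a k, x k}, {z, x k}})
    \<union> (\<Union>k\<in>residues h. {{b k, y}})"
  \<comment> \<open>The edge {y, x 0} belongs to no pair {i, -i}, so it becomes the pendant edge of
    the hub triangle with i = 1, which exists because h is at least 1.\<close>
  define S3 where "S3 = (\<Union>i\<in>{1..int h}. {{y, x i}})
    \<union> (\<Union>i\<in>{1..int h}. {{y, x (- i)}, {x i, x (- i)}}) \<union> (\<Union>i\<in>{1::int}. {{y, x 0}})"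
  have c1: "coverable V S1
      (2 * card (residues h) * h + card (residues h) * h + card (insert (int h, 1) N))"
    unfolding S1_def
  proof (rule coverable_wheels)
    show sub: "insert (int h, 1) N \<subseteq> residues h \<times> {1..int h}"
      using h by (auto simp: N_def residues_def)
    show "s k d \<in> {a (res h (k + d)), a (res h (k - d)), x k} \<and> \<not> {s k d, t k d} \<subseteq> V"
      if "(k, d) \<in> insert (int h, 1) N" for k d
    proof -
      have "k \<in> residues h" using that sub by auto
      then show ?thesis using xV yV top by (auto simp: s_def t_def)
    qed
  qed (use xV finite_residues in auto)
  have c2: "coverable V S2 (2 * card (residues h) + card (residues h) + card (residues h))"
    unfolding S2_def using xV yV
    by (intro coverable_kites) (auto simp: finite_residues b_def)
  have c3: "coverable V S3 (2 * card {1..int h} + card {1..int h} + card {1::int})"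
    unfolding S3_def
  proof (rule coverable_kites)
    show "x (- i) \<notin> V" if "i \<in> {1..int h}" for i using that xV by (auto simp: residues_def)
  qed (use h yV in auto)
  have yx: "{y, x k} \<in> S3" if "k \<in> residues h" for k
  proof (cases "k = 0")
    case True
    then show ?thesis unfolding S3_def by simp
  next
    case False
    then have "\<bar>k\<bar> \<in> {1..int h}" using that by (auto simp: residues_def)
    then have "{{y, x \<bar>k\<bar>}, {y, x (- \<bar>k\<bar>)}} \<subseteq> S3" unfolding S3_def by blast
    then show ?thesis by (cases "k < 0") simp_all
  qed
  have "complete_edges (V \<union> W) \<subseteq> S1 \<union> S2 \<union> S3"
  proof (rule complete_edges_subsetI)
    have aa: "{a i, a j} \<in> S1" if ij: "i \<in> residues h" "j \<in> residues h" "a i \<noteq> a j" for i j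
    proof -
      have "i \<noteq> j" using ij(3) by auto
      then obtain k d where "k \<in> residues h" "d \<in> {1..int h}"
          "{a i, a j} = {a (res h (k + d)), a (res h (k - d))}"
        by (rule base_edge[OF ij(1,2)])
      then show ?thesis unfolding S1_def by blast
    qed
    fix u u' assume "u \<in> V" "u' \<in> V" "u \<noteq> u'"
    then show "{u, u'} \<in> S1 \<union> S2 \<union> S3"
      unfolding V using aa by (auto simp: S2_def insert_commute)
  next
    have zy: "{z, y} \<in> S2"
    proof -
      have "- int h \<in> residues h" by (simp add: residues_def)
      then have "{b (- int h), y} \<in> S2" unfolding S2_def by blast
      then show ?thesis by (simp add: b_def)
    qed
    have ay: "{a i, y} \<in> S1 \<union> S2" if "i \<in> residues h" for i
    proof (cases "i = - int h")
      case True
      have "{s (int h) 1, t (int h) 1} \<in> S1" unfolding S1_def by blast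
      then show ?thesis using True by (simp add: s_def t_def)
    next
      case False
      have "{b i, y} \<in> S2" unfolding S2_def using that by blast
      then show ?thesis using False by (simp add: b_def)
    qed
    fix u u' assume u: "u \<in> V" "u' \<in> W"
    consider "u = z" "u' = y" | i where "i \<in> residues h" "u = a i" "u' = y"
      | k where "k \<in> residues h" "u = z" "u' = x k"
      | i k where "i \<in> residues h" "k \<in> residues h" "u = a i" "u' = x k"
      using u V W by auto
    then show "{u, u'} \<in> S1 \<union> S2 \<union> S3"
    proof cases
      case 1
      then show ?thesis using zy by simp
    next
      case 2
      then show ?thesis using ay by simp
    next
      case 3
      then show ?thesis unfolding S2_def by blast
    next
      case 4
      show ?thesis
      proof (cases "i = k")
        case True
        then show ?thesis using 4 unfolding S2_def by blast
      next
        case False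
        then obtain d where "d \<in> {1..int h}"
            "{a i, u'} \<in> {{a (res h (k + d)), u'}, {a (res h (k - d)), u'}}"
          by (rule spoke_edge[OF 4(1,2)])
        then show ?thesis using 4 unfolding S1_def by blast
      qed
    qed
  next
    have xx: "{x k, x l} \<in> S1 \<union> S3" if kl: "k \<in> residues h" "l \<in> residues h" "k \<noteq> l" for k l
    proof -
      obtain k' l' d where d: "d \<in> {1..int h}" "l' = res h (k' + d)" "{k', l'} = {k, l}"
          "k' \<in> residues h" "l' \<in> residues h"
        by (rule rim_edge[OF kl(1,2) order_refl kl(3)])
      have uu: "{x k, x l} = {x k', x l'}" using d(3) by (auto simp: doubleton_eq_iff)
      have neq: "k' \<noteq> l'" using d(3) kl(3) by auto
      show ?thesis
      proof (cases "l' = - k'")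
        case True
        then have "\<bar>k'\<bar> \<in> {1..int h}" using d(4) neq by (auto simp: residues_def)
        then have "{x \<bar>k'\<bar>, x (- \<bar>k'\<bar>)} \<in> S3" unfolding S3_def by blast
        moreover have "{x k, x l} = {x \<bar>k'\<bar>, x (- \<bar>k'\<bar>)}" using uu True by (auto simp: abs_if)
        ultimately show ?thesis by simp
      next
        case False
        then have "(k', d) \<in> N" using d by (auto simp: N_def)
        then have "{s k' d, t k' d} \<in> S1" unfolding S1_def by blast
        moreover have "\<not> (k' = int h \<and> d = 1)" using False d(2) top by auto
        ultimately show ?thesis using d(2) uu by (simp add: s_def t_def)
      qed
    qed
    fix u u' assume "u \<in> W" "u' \<in> W" "u \<noteq> u'"
    then consider k where "k \<in> residues h" "u = y" "u' = x k"
      | k where "k \<in> residues h" "u = x k" "u' = y"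
      | k l where "k \<in> residues h" "l \<in> residues h" "u = x k" "u' = x l" "k \<noteq> l"
      using W by auto
    then show "{u, u'} \<in> S1 \<union> S2 \<union> S3"
      by cases (use yx xx in \<open>auto simp: insert_commute\<close>)
  qed
  moreover have "2 * card (residues h) * h + card (residues h) * h + card (insert (int h, 1) N)
      + (2 * card (residues h) + card (residues h) + card (residues h))
      + (2 * card {1..int h} + card {1..int h} + card {1::int}) \<le> (h + 1) * (8 * h + 6)"
    using J by (simp add: card_residues algebra_simps)
  ultimately show ?thesis by (rule coverable_mono[OF coverable_Un[OF coverable_Un[OF c1 c2] c3]])
qed

section \<open>Optimal groomings\<close>

text \<open>The covers only need labellings that are onto, so injectivity is dropped.\<close>

lemma surjection_of_card_eq:
  assumes "finite A" "finite B" "card A = card B"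
  obtains f where "B = f ` A"
  using finite_same_card_bij[OF assms] by (auto simp: bij_betw_def)

text \<open>Since w < v, every vertex of \<open>W\<close> gets a matching of its own: there are 2h +
  1 of them for v = 2h + 2, and for v = 2h + 1 the 2h matchings other than the one at 0
  suffice.\<close>

lemma coverable_unbalanced:
  assumes fin: "finite V" "finite W" and disj: "V \<inter> W = {}" and card: "card W < card V"
  shows "coverable V (complete_edges (V \<union> W))
    (2 * (card V choose 2) + (card W choose 2) + (card V * card W + 1) div 2)"
proof (cases "even (card V)")
  case True
  define h where "h = card V div 2 - 1"
  have h: "card V = 2 * h + 2" using True card unfolding h_def by auto
  obtain z where z: "z \<in> V" using card by (metis card.empty ex_in_conv not_less0)
  have "card (residues h) = card (V - {z})" using z h fin by (simp add: card_residues)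
  then obtain a where a: "V - {z} = a ` residues h"
    using fin by (metis surjection_of_card_eq finite_residues finite_Diff)
  have "card W \<le> card (residues h)" using card h by (simp add: card_residues)
  then obtain I where I: "I \<subseteq> residues h" "card I = card W" "finite I"
    by (rule obtain_subset_with_card_n)
  obtain x where x: "W = x ` I" by (rule surjection_of_card_eq[OF I(3) fin(2) I(2)])
  have "V = insert z (a ` residues h)" using a z by auto
  from coverable_even[OF this x I(1) disj]
  show ?thesis
  proof (rule coverable_mono)
    have "(card V * card W + 1) div 2 = (h + 1) * card W" by (simp add: h)
    moreover have "2 * (card V choose 2) = 2 * (h + 1) * (2 * h + 1)"
      by (simp add: two_choose_two h)
    ultimately show "2 * (h + 1) * (2 * h + 1) + (h + 1) * card I + (card I choose 2)
        \<le> 2 * (card V choose 2) + (card W choose 2) + (card V * card W + 1) div 2"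
      by (simp add: I(2))
  qed simp
next
  case False
  define h where "h = card V div 2"
  define p where "p = card W div 2"
  define q where "q = (card W + 1) div 2"
  have h: "card V = 2 * h + 1" using False unfolding h_def by simp
  have pq: "p \<le> q" "q \<le> h" "p + q = card W"
    using card h unfolding p_def q_def by auto
  have "card (residues h) = card V" using h by (simp add: card_residues)
  then obtain a where a: "V = a ` residues h"
    using surjection_of_card_eq[OF finite_residues fin(1)] by metis
  have "card ({- int p..int q} - {0}) = card W" using pq by simp
  then obtain x where x: "W = x ` ({- int p..int q} - {0})"
    using surjection_of_card_eq[OF _ fin(2)] by (metis finite_Diff finite_atLeastAtMost_int)
  from coverable_odd[OF a x refl pq(1,2) disj]
  show ?thesis
  proof (rule coverable_mono)
    \<comment> \<open>The subtraction of p in the cost is truncated, so p must not exceed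
      binom(w,2).\<close>
    have "card W \<le> 2 * (card W choose 2) \<or> card W \<le> 1"
      by (cases "card W") (auto simp: two_choose_two)
    then have "p \<le> (card W choose 2)" unfolding p_def by auto
    moreover have "(card V * card W + 1) div 2 = card W * h + q"
    proof -
      have "card V * card W + 1 = 2 * (card W * h) + (card W + 1)" by (simp add: h algebra_simps)
      then show ?thesis unfolding q_def by linarith
    qed
    moreover have "2 * (card V choose 2) = 4 * h * h + 2 * h"
      by (simp add: two_choose_two h algebra_simps)
    ultimately show "4 * h * h + 2 * h + (p + q) * h + (p + q) + (((p + q) choose 2) - p)
        \<le> 2 * (card V choose 2) + (card W choose 2) + (card V * card W + 1) div 2"
      using pq(3) by auto
  qed simp
qed

lemma coverable_balanced:
  assumes fin: "finite V" "finite W" and disj: "V \<inter> W = {}"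
    and card: "card V = card W" "card V \<ge> 3"
  shows "coverable V (complete_edges (V \<union> W)) ((card V + card W) choose 2)"
proof (cases "even (card V)")
  case True
  define h where "h = card V div 2 - 1"
  have h: "card V = 2 * h + 2" "h \<ge> 1" using True card(2) unfolding h_def by presburger+
  obtain z where z: "z \<in> V" using card by (metis card.empty ex_in_conv not_numeral_le_zero)
  obtain y where y: "y \<in> W" using card by (metis card.empty ex_in_conv not_numeral_le_zero)
  have "card (residues h) = card (V - {z})" using z h fin by (simp add: card_residues)
  then obtain a where a: "V - {z} = a ` residues h"
    using fin by (metis surjection_of_card_eq finite_residues finite_Diff)
  have "card (residues h) = card (W - {y})" using y h fin card by (simp add: card_residues)
  then obtain x where x: "W - {y} = x ` residues h"
    using fin by (metis surjection_of_card_eq finite_residues finite_Diff)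
  have "V = insert z (a ` residues h)" "W = insert y (x ` residues h)" using a x z y by auto
  from coverable_balanced_even[OF this disj h(2)]
  show ?thesis
  proof (rule coverable_mono)
    have "2 * ((card V + card W) choose 2) = 2 * ((h + 1) * (8 * h + 6))"
      unfolding two_choose_two card(1)[symmetric] h by (simp add: algebra_simps)
    then show "(h + 1) * (8 * h + 6) \<le> (card V + card W) choose 2" by simp
  qed simp
next
  case False
  define h where "h = card V div 2"
  have h: "card V = 2 * h + 1" "h \<ge> 1" using False card(2) unfolding h_def by presburger+
  have "card (residues h) = card V" using h by (simp add: card_residues)
  then obtain a where a: "V = a ` residues h"
    using surjection_of_card_eq[OF finite_residues fin(1)] by metis
  have "card (residues h) = card W" using h card by (simp add: card_residues)
  then obtain x where x: "W = x ` residues h"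
    using surjection_of_card_eq[OF finite_residues fin(2)] by metis
  from coverable_balanced_odd[OF a x disj h(2)]
  show ?thesis
  proof (rule coverable_mono)
    have "2 * ((card V + card W) choose 2) = 2 * ((2 * h + 1) * (4 * h + 1))"
      unfolding two_choose_two card(1)[symmetric] h by (simp add: algebra_simps)
    then show "(2 * h + 1) * (4 * h + 1) \<le> (card V + card W) choose 2" by simp
  qed simp
qed

text \<open>\<open>V\<close> is enlarged to half of \<open>X\<close>, rounded up. For odd n this
  gives v = w + 1; for even n parity leaves only v = w.\<close>

lemma coverable_few_first_period:
  assumes fin: "finite X" and V: "V \<subseteq> X" and card: "2 * card V \<le> card X + 1" "card X \<ge> 5"
  shows "coverable V (complete_edges X) (card X choose 2)"
proof -
  have "(card X + 1) div 2 - card V \<le> card (X - V)"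
    using card_Diff_subset[OF rev_finite_subset[OF fin V] V] card by linarith
  then obtain T where T: "T \<subseteq> X - V" "card T = (card X + 1) div 2 - card V"
    by (rule obtain_subset_with_card_n)
  define U where "U = V \<union> T"
  define W where "W = X - U"
  have UX: "U \<subseteq> X" using V T unfolding U_def by auto
  have finUW: "finite U" "finite W" using UX fin finite_subset unfolding W_def by auto
  have disj: "U \<inter> W = {}" and UW: "U \<union> W = X" using UX unfolding W_def by auto
  have "card U = card V + card T"
    using T V fin unfolding U_def by (intro card_Un_disjoint) (auto intro: finite_subset)
  then have cU: "card U = (card X + 1) div 2" using T(2) card by linarith
  have cUW: "card U + card W = card X"
    using card_Un_disjoint[OF finUW disj] UW by simp
  have "coverable U (complete_edges (U \<union> W)) (card X choose 2)"
  proof (cases "even (card X)")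
    case True
    \<comment> \<open>An even n that is at least 5 is at least 6, which gives h \<ge> 1 in both
      balanced constructions.\<close>
    then have "card U = card W" "card U \<ge> 3" using cU cUW card(2) by presburger+
    from coverable_balanced[OF finUW disj this] show ?thesis by (simp only: cUW)
  next
    case False
    then have c: "card U = Suc (card W)" using cU cUW by presburger
    from coverable_unbalanced[OF finUW disj] c
    have "coverable U (complete_edges (U \<union> W))
        (2 * (card U choose 2) + (card W choose 2) + (card U * card W + 1) div 2)" by simp
    moreover have "2 * (card U choose 2) = card U * card W"
      unfolding two_choose_two using c by simp
    then have "2 * (card U choose 2) + (card W choose 2) + (card U * card W + 1) div 2
        = card X choose 2"
      unfolding cUW[symmetric] choose_two_add by presburger
    ultimately show ?thesis by simp
  qed
  then show ?thesis
    unfolding UW by (rule coverable_antimono) (simp add: U_def)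
qed

theorem theorem3p1:
  fixes X V :: "'a set" and v w :: nat
  assumes "finite X" and "V \<subseteq> X"
    and "card X = v + w" and "card V = v"
    and "v + w \<ge> 5"
  shows "(v \<le> w + 1 \<longrightarrow> two_period_cost_ON X V 4 1 = cost_ON X 4) \<and>
         (v \<ge> w + 1 \<longrightarrow>
            int (two_period_cost_ON X V 4 1)
              = int ((v + w) choose 2) + int (v choose 2) - \<lfloor>real (v * w) / 2\<rfloor>)"
proof (intro conjI impI)
  assume "v \<le> w + 1"
  then have "coverable V (complete_edges X) (card X choose 2)"
    using assms by (intro coverable_few_first_period) auto
  then obtain P where P: "two_period_grooming X V 4 1 P" "drop_cost P \<le> card X choose 2"
    using grooming_of_coverable[OF assms(1)] by blast
  then have gr: "grooming X 4 P" by (simp add: two_period_grooming_def)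
  \<comment> \<open>The grooming \<open>P\<close> respects the constraint on \<open>V\<close> and
    meets the bound valid without it, so it attains both minima.\<close>
  have eq: "drop_cost P = card X choose 2"
    using P(2) drop_cost_ge[OF assms(1) gr] by simp
  have "two_period_cost_ON X V 4 1 = card X choose 2"
    unfolding two_period_cost_ON_def
    using P(1) eq drop_cost_ge[OF assms(1)]
    by (intro Least_equality) (auto simp: two_period_grooming_def)
  moreover have "cost_ON X 4 = card X choose 2"
    unfolding cost_ON_def using gr eq drop_cost_ge[OF assms(1)]
    by (intro Least_equality) auto
  ultimately show "two_period_cost_ON X V 4 1 = cost_ON X 4" by simp
next
  assume vw: "v \<ge> w + 1"
  define W where "W = X - V"
  \<comment> \<open>This is the claimed value free of subtraction: binom(v+w,2) contributes v w, and
    v w minus its half rounded down is its half rounded up.\<close>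
  define c where "c = 2 * (v choose 2) + (w choose 2) + (v * w + 1) div 2"
  have fin: "finite V" "finite W" using assms(1,2) finite_subset unfolding W_def by auto
  have disj: "V \<inter> W = {}" and X: "X = V \<union> W" using assms(2) unfolding W_def by auto
  have cW: "card W = w" using assms(1-4) fin by (simp add: W_def card_Diff_subset)
  have ge: "c \<le> drop_cost P" if "two_period_grooming X V 4 1 P" for P
    using two_period_drop_cost_ge[OF fin disj that[unfolded X]] assms(3,4) cW
    unfolding X c_def by (simp add: choose_two_add)
  have "coverable V (complete_edges X) c"
    using coverable_unbalanced[OF fin disj] vw cW assms(4) unfolding c_def X by simp
  then obtain P where P: "two_period_grooming X V 4 1 P" "drop_cost P \<le> c"
    using grooming_of_coverable[OF assms(1)] by blast
  have "two_period_cost_ON X V 4 1 = c"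
    unfolding two_period_cost_ON_def
    using P ge by (intro Least_equality) (auto intro: le_antisym)
  moreover have "\<lfloor>real (v * w) / 2\<rfloor> = int (v * w div 2)"
    using floor_divide_of_nat_eq[of "v * w" 2] by simp
  moreover have "int c = int ((v + w) choose 2) + int (v choose 2) - int (v * w div 2)"
    unfolding c_def choose_two_add by linarith
  ultimately show "int (two_period_cost_ON X V 4 1)
      = int ((v + w) choose 2) + int (v choose 2) - \<lfloor>real (v * w) / 2\<rfloor>" by simp
qed

end
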